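(* For each $s \geq 1$ and $n \geq 3$, we have $$R(\mathcal{P}_n^{2s,s},\mathcal{P}_3^{2s,s})=(n+1)s+1.$$
   Context: An $r$-uniform hypergraph $H=(V,E)$ consists of a vertex set $V$ and a collection $E$ of $r$-subsets of $V$; $K_N^r$ denotes the complete $r$-uniform hypergraph on $N$ vertices. For $r$-uniform hypergraphs $H_1,H_2$, the Ramsey number $R(H_1,H_2)$ is the minimum $N$ such that each red-blue coloring of the edges of $K_N^r$ contains either a red copy of $H_1$ or a blue copy of $H_2$. For integers $s,n\ge 1$, the path $\mathcal{P}_n^{2s,s}$ of length $n$ is the $2s$-uniform hypergraph on distinct vertices $v_1,v_2,\ldots,v_{(n+1)s}$ whose $n$ edges are $\{v_{1+is},\ldots,v_{(i+2)s}\}$ for $0\le i\le n-1$. Equivalently, it is given by pairwise disjoint $s$-sets $A_1,\ldots,A_{n+1}$ with edges $A_i\cup A_{i+1}$ for $1\le i\le n$. *)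

theory Defs
  imports Main
begin

record 'a hypergraph =
  verts :: "'a set"
  edges :: "'a set set"

definition uniform :: "nat \<Rightarrow> 'a hypergraph \<Rightarrow> bool" where
  "uniform r H \<longleftrightarrow> (\<forall>e\<in>edges H. e \<subseteq> verts H \<and> finite e \<and> card e = r)"

definition complete_hypergraph :: "nat \<Rightarrow> nat \<Rightarrow> nat hypergraph" where
  "complete_hypergraph r N = \<lparr>verts = {..<N}, edges = {e. e \<subseteq> {..<N} \<and> card e = r}\<rparr>"

text \<open>Copies are subhypergraphs up to isomorphism; they need not be induced.\<close>

definition contains_copy :: "'b hypergraph \<Rightarrow> 'a hypergraph \<Rightarrow> bool" where
  "contains_copy G H \<longleftrightarrow>
     (\<exists>f. inj_on f (verts H) \<and> f ` verts H \<subseteq> verts G \<and> (\<forall>e\<in>edges H. f ` e \<in> edges G))"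

datatype colour = Red | Blue

definition colour_class :: "'a hypergraph \<Rightarrow> ('a set \<Rightarrow> colour) \<Rightarrow> colour \<Rightarrow> 'a hypergraph" where
  "colour_class G c k = \<lparr>verts = verts G, edges = {e \<in> edges G. c e = k}\<rparr>"

text \<open>
  Colourings are total functions on sets of vertices, but only their values on the edges of the
  complete hypergraph matter.
\<close>

definition arrows :: "nat \<Rightarrow> nat \<Rightarrow> 'a hypergraph \<Rightarrow> 'b hypergraph \<Rightarrow> bool" where
  "arrows r N H1 H2 \<longleftrightarrow>
     (\<forall>c :: nat set \<Rightarrow> colour.
        contains_copy (colour_class (complete_hypergraph r N) c Red) H1 \<or>
        contains_copy (colour_class (complete_hypergraph r N) c Blue) H2)"

text \<open>
  Meant for \<open>r\<close>-uniform \<open>H1\<close> and \<open>H2\<close>. If no \<open>N\<close> had the required property, the value would be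
  unspecified; for finite hypergraphs Ramsey's theorem excludes this.
\<close>

definition ramsey_number :: "nat \<Rightarrow> 'a hypergraph \<Rightarrow> 'b hypergraph \<Rightarrow> nat" where
  "ramsey_number r H1 H2 = (LEAST N. arrows r N H1 H2)"

text \<open>The path of length \<open>n\<close>, where the number \<open>j\<close> stands for the vertex \<open>v\<^sub>j\<close>.\<close>

definition hyperpath :: "nat \<Rightarrow> nat \<Rightarrow> nat hypergraph" where
  "hyperpath s n =
     \<lparr>verts = {1..(n + 1) * s}, edges = (\<lambda>i. {1 + i * s..(i + 2) * s}) ` {0..<n}\<rparr>"

lemma uniform_complete_hypergraph: "uniform r (complete_hypergraph r N)"
  by (auto simp: uniform_def complete_hypergraph_def intro: finite_subset)

lemma uniform_hyperpath: "uniform (2 * s) (hyperpath s n)"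
proof -
  have "(i + 2) * s \<le> (n + 1) * s" if "i < n" for i
    using that by (intro mult_le_mono1) simp
  then have "{1 + i * s..(i + 2) * s} \<subseteq> {1..(n + 1) * s}" if "i < n" for i
    using that by (intro atLeastatMost_subset_iff[THEN iffD2]) auto
  then show ?thesis
    by (fastforce simp: uniform_def hyperpath_def)
qed

lemma card_edges_hyperpath:
  assumes "s \<ge> 1"
  shows "card (edges (hyperpath s n)) = n"
proof -
  have "inj_on (\<lambda>i. {1 + i * s..(i + 2) * s}) {0..<n}"
    using assms by (intro inj_onI) (auto simp: Icc_eq_Icc)
  then show ?thesis
    by (simp add: hyperpath_def card_image)
qed

end

theory Submission
  imports Defs
begin

text \<open>
  Lower bound: colour an edge blue iff it contains a fixed vertex \<open>v\<close>. A red path misses \<open>v\<close>, and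
  a blue path of length 3 would have two disjoint edges through \<open>v\<close>.

  Upper bound: induction on \<open>n\<close>. Suppose a red path \<open>X, Y, \<dots>, L\<close> of \<open>s\<close>-sets is given and neither
  a longer red path nor a blue path of length 3 exists. Let \<open>U\<close> be the set of \<open>2s + 1\<close> vertices
  outside \<open>Y, \<dots>, L\<close>. For each \<open>s\<close>-set \<open>B \<subseteq> U\<close> disjoint from \<open>X\<close> the edges \<open>B \<union> Y\<close> and \<open>B \<union> L\<close> turn
  out to be blue, so \<open>X' \<union> Y\<close> is red for each \<open>s\<close>-set \<open>X' \<subseteq> U\<close> disjoint from such a \<open>B\<close>. Since the
  odd graph (\<open>s\<close>-subsets of a \<open>(2s + 1)\<close>-set, adjacent when disjoint) is connected and not bipartite, some
  edge is both red and blue. The case \<open>n = 3\<close> uses the same argument, starting from three disjoint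
  \<open>s\<close>-sets that span edges of both colours.
\<close>

section \<open>Connectivity of the odd graph\<close>

text \<open>Exchanging one element is a walk of length two: \<open>X\<close> and
  \<open>insert y (X - {x})\<close> are both disjoint from the \<open>s\<close>-set
  \<open>U - insert y X\<close>, through which \<open>P\<close> passes by way of \<open>Q\<close>.
  Exchanges lead from \<open>X\<close> to every \<open>Y\<close>, also to one disjoint from
  \<open>X\<close>, where \<open>P\<close> and \<open>Q\<close> will clash.\<close>

lemma odd_graph_walk:
  assumes "finite U" and cardU: "card U = 2 * s + 1"
    and PQ: "\<And>X B. X \<subseteq> U \<Longrightarrow> card X = s \<Longrightarrow> B \<subseteq> U \<Longrightarrow> card B = s \<Longrightarrow> disjnt X B \<Longrightarrow> P X \<Longrightarrow> Q B"
    and QP: "\<And>X B. X \<subseteq> U \<Longrightarrow> card X = s \<Longrightarrow> B \<subseteq> U \<Longrightarrow> card B = s \<Longrightarrow> disjnt X B \<Longrightarrow> Q B \<Longrightarrow> P X"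
    and "X \<subseteq> U" "card X = s" "P X" "Y \<subseteq> U" "card Y = s"
  shows "P Y"
  using assms(5-9)
proof (induction "card (Y - X)" arbitrary: X)
  case 0
  have fin: "finite X" "finite Y"
    using 0 \<open>finite U\<close> finite_subset by auto
  then have "Y \<subseteq> X"
    using 0 by simp
  then have "Y = X"
    using 0 fin by (simp add: card_subset_eq)
  then show ?case
    using 0 by simp
next
  case (Suc k)
  have fin: "finite X" "finite Y"
    using Suc.prems \<open>finite U\<close> finite_subset by auto
  have "card (Y - X) = card (X - Y)"
    using fin Suc.prems by (metis card_le_sym_Diff le_antisym order_refl)
  then obtain x y where x: "x \<in> X" "x \<notin> Y" and y: "y \<in> Y" "y \<notin> X"
    using Suc.hyps(2) by (metis Diff_iff card.empty ex_in_conv nat.distinct(1))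
  define X' where "X' = insert y (X - {x})"
  define B where "B = U - insert y X"
  have X': "X' \<subseteq> U" "card X' = s"
    using Suc.prems x y fin card_Suc_Diff1[of X x] by (auto simp: X'_def card_insert_if)
  have "insert y X \<subseteq> U" "card (insert y X) = Suc s"
    using Suc.prems y fin by auto
  then have B: "B \<subseteq> U" "card B = s"
    using cardU fin by (auto simp: B_def card_Diff_subset)
  have "Q B"
    using PQ[OF Suc.prems(1,2) B _ \<open>P X\<close>] by (auto simp: disjnt_def B_def)
  then have "P X'"
    using QP[OF X' B] by (auto simp: disjnt_def B_def X'_def)
  moreover have "Y - X' = (Y - X) - {y}"
    using x by (auto simp: X'_def)
  then have "k = card (Y - X')"
    using Suc.hyps(2) x y fin by simp
  ultimately show ?case
    using Suc.hyps(1) X' Suc.prems(4,5) by blast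
qed

section \<open>Paths as lists of disjoint blocks\<close>

text \<open>A colour is a predicate \<open>R\<close> on edges, so that the other colour is its
  negation and the colours can be swapped by instantiation. A path of length \<open>n\<close> has
  \<open>n + 1\<close> blocks.\<close>

definition set_path :: "('a set \<Rightarrow> bool) \<Rightarrow> nat \<Rightarrow> 'a set \<Rightarrow> 'a set list \<Rightarrow> bool" where
  "set_path R s V As \<longleftrightarrow>
     (\<forall>A\<in>set As. A \<subseteq> V \<and> card A = s) \<and> sorted_wrt disjnt As \<and> successively (\<lambda>A B. R (A \<union> B)) As"

lemma card_Union_disjoint_list:
  assumes "\<forall>A\<in>set As. finite A \<and> card A = s" "sorted_wrt disjnt As"
  shows "card (\<Union>(set As)) = length As * s"
  using assms
proof (induction As)
  case (Cons A As)
  then have "A \<inter> \<Union>(set As) = {}"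
    by (auto simp: disjnt_def)
  with Cons show ?case
    by (simp add: card_Un_disjoint)
qed simp

lemma exists_disjoint_subset:
  assumes "finite V" "W \<subseteq> V" "card W + s \<le> card V"
  obtains B where "B \<subseteq> V" "card B = s" "disjnt B W"
proof -
  have "s \<le> card (V - W)"
    using assms by (simp add: card_Diff_subset finite_subset)
  then obtain B where "B \<subseteq> V - W" "card B = s"
    by (meson obtain_subset_with_card_n)
  then show thesis
    using that[of B] by (auto simp: disjnt_def)
qed

section \<open>Base case: length 3 in both colours\<close>

text \<open>If \<open>X'\<close> is joined to \<open>C\<close> and \<open>D\<close> in
  \<open>R\<close>, then an \<open>R\<close>-edge from a disjoint \<open>B'\<close> to either gives
  the path \<open>B', C, X', D\<close> or \<open>B', D, X', C\<close>. The same holds for the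
  negation of \<open>R\<close>, so \<open>P\<close> and \<open>Q\<close> alternate along the odd
  graph on \<open>U\<close>.\<close>

lemma mixed_triangle_contradiction:
  assumes "finite V" and cardV: "card V = 4 * s + 1"
    and no_R: "\<And>A B C D. \<not> set_path R s V [A, B, C, D]"
    and no_nR: "\<And>A B C D. \<not> set_path (\<lambda>e. \<not> R e) s V [A, B, C, D]"
    and sets: "X \<subseteq> V" "C \<subseteq> V" "D \<subseteq> V" "card X = s" "card C = s" "card D = s"
    and disj: "disjnt X C" "disjnt X D" "disjnt C D"
    and cols: "R (X \<union> C)" "R (X \<union> D)" "\<not> R (C \<union> D)"
  shows False
proof -
  define U where "U = V - (C \<union> D)"
  define P where "P = (\<lambda>X. R (X \<union> C) \<and> R (X \<union> D))"
  define Q where "Q = (\<lambda>B. \<not> R (B \<union> C) \<and> \<not> R (B \<union> D))"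
  have fin: "finite C" "finite D"
    using sets \<open>finite V\<close> finite_subset by auto
  have "card (C \<union> D) = 2 * s"
    using fin sets disj by (simp add: card_Un_disjnt)
  then have U: "finite U" "card U = 2 * s + 1"
    using cardV \<open>finite V\<close> fin sets by (auto simp: U_def card_Diff_subset)
  have XU: "X \<subseteq> U"
    using sets disj by (auto simp: U_def disjnt_def)
  obtain B where B: "B \<subseteq> U" "card B = s" "disjnt B X"
    using exists_disjoint_subset[OF U(1) XU, of s] U sets by auto
  have PQ: "Q B'" if "X' \<subseteq> U" "card X' = s" "B' \<subseteq> U" "card B' = s" "disjnt X' B'" "P X'" for X' B'
    using no_R[of B' C X' D] no_R[of B' D X' C] that sets disj
    by (auto simp: set_path_def P_def Q_def U_def disjnt_def Un_commute)
  have QP: "P X'" if "X' \<subseteq> U" "card X' = s" "B' \<subseteq> U" "card B' = s" "disjnt X' B'" "Q B'" for X' B'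
    using no_nR[of X' C B' D] no_nR[of X' D B' C] that sets disj
    by (auto simp: set_path_def P_def Q_def U_def disjnt_def Un_commute)
  have "P X"
    using cols by (simp add: P_def)
  have "P B"
    by (rule odd_graph_walk[where P = P and Q = Q, OF U PQ QP XU sets(4) \<open>P X\<close> B(1,2)])
  moreover have "Q B"
    using PQ[OF XU sets(4) B(1,2) _ \<open>P X\<close>] B(3) by (simp add: disjnt_sym)
  ultimately show False
    by (simp add: P_def Q_def)
qed

text \<open>Disjoint triples are monochromatic. A fourth set \<open>D\<close> is joined to
  \<open>A\<close> and to \<open>B\<close> in the colour opposite to that of the triple
  \<open>A, B, C\<close>, or else \<open>D, A, B, C\<close> or \<open>D, B, A, C\<close> is a
  monochromatic path; so the triple \<open>D, A, B\<close> is mixed.\<close>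

lemma set_path_ramsey_base:
  fixes R :: "'a set \<Rightarrow> bool"
  assumes "finite V" and cardV: "card V = 4 * s + 1"
    and no_R: "\<And>A B C D. \<not> set_path R s V [A, B, C, D]"
    and no_nR: "\<And>A B C D. \<not> set_path (\<lambda>e. \<not> R e) s V [A, B, C, D]"
  shows False
proof -
  have contra: False
    if "X \<subseteq> V" "C \<subseteq> V" "D \<subseteq> V" "card X = s" "card C = s" "card D = s"
      "disjnt X C" "disjnt X D" "disjnt C D"
      "R (X \<union> C) \<longleftrightarrow> R (X \<union> D)" "R (X \<union> C) \<longleftrightarrow> \<not> R (C \<union> D)" for X C D
  proof (cases "R (X \<union> C)")
    case True
    then show False
      using mixed_triangle_contradiction[OF assms(1-4) that(1-9)] that by blast
  next
    case False
    have "\<not> set_path (\<lambda>e. \<not> \<not> R e) s V [A, B, C, D]" for A B C D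
      using no_R by simp
    from mixed_triangle_contradiction[where R = "\<lambda>e. \<not> R e", OF assms(1,2,4) this that(1-9)]
    show False
      using False that by blast
  qed
  obtain A where A: "A \<subseteq> V" "card A = s"
    using exists_disjoint_subset[of V "{}" s] cardV \<open>finite V\<close> by auto
  then have finA: "finite A"
    using \<open>finite V\<close> finite_subset by auto
  obtain B where B: "B \<subseteq> V" "card B = s" "disjnt B A"
    using exists_disjoint_subset[of V A s] A cardV \<open>finite V\<close> by auto
  then have finB: "finite B"
    using \<open>finite V\<close> finite_subset by auto
  have AB: "card (A \<union> B) = 2 * s"
    using A B finA finB by (simp add: card_Un_disjnt disjnt_sym)
  obtain C where C: "C \<subseteq> V" "card C = s" "disjnt C (A \<union> B)"
    using exists_disjoint_subset[of V "A \<union> B" s] A B AB cardV \<open>finite V\<close> by auto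
  then have finC: "finite C"
    using \<open>finite V\<close> finite_subset by auto
  have "disjnt (A \<union> B) C"
    using C by (simp add: disjnt_sym)
  then have ABC: "card (A \<union> B \<union> C) = 3 * s"
    using C finA finB finC AB by (subst card_Un_disjnt) auto
  obtain D where D: "D \<subseteq> V" "card D = s" "disjnt D (A \<union> B \<union> C)"
    using exists_disjoint_subset[of V "A \<union> B \<union> C" s] A B C ABC cardV \<open>finite V\<close> by auto
  note sets = A(1) B(1) C(1) D(1) A(2) B(2) C(2) D(2)
  have disj: "disjnt A B" "disjnt A C" "disjnt B C" "disjnt D A" "disjnt D B" "disjnt D C"
    "disjnt B A" "disjnt C A" "disjnt C B"
    using B(3) C(3) D(3) by (auto simp: disjnt_def)
  \<comment> \<open>Two of the three edges agree, so each set of the triple is tried as their common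
    block.\<close>
  have mono: "R (A \<union> B) = R (A \<union> C)" "R (A \<union> B) = R (B \<union> C)"
    using contra[of A B C] contra[of B A C] contra[of C A B] sets disj
    by (auto simp: Un_commute)
  have "R (D \<union> A) \<noteq> R (A \<union> B)" "R (D \<union> B) \<noteq> R (A \<union> B)"
    using no_R[of D A B C] no_nR[of D A B C] no_R[of D B A C] no_nR[of D B A C] sets disj mono
    by (auto simp: set_path_def Un_commute)
  then show False
    using contra[of D A B] sets disj by auto
qed

section \<open>Prolonging a red path by one block\<close>

text \<open>Again \<open>P\<close> and \<open>Q\<close> alternate between disjoint
  \<open>s\<close>-sets of \<open>U\<close>. \<open>Q\<close> records both ends \<open>Y\<close> and
  \<open>L\<close> of the fixed part, because a failure of \<open>P X'\<close> then yields the path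
  \<open>X', Y, B', L\<close> in the other colour.\<close>

lemma set_path_extension:
  assumes "finite V" and cardV: "card V = (length Zs + 4) * s + 1"
    and path: "set_path R s V (X # Y # Zs @ [L])" and "Zs \<noteq> []"
    and no_R: "\<And>As. length As = length Zs + 4 \<Longrightarrow> \<not> set_path R s V As"
    and no_nR: "\<And>A B C D. \<not> set_path (\<lambda>e. \<not> R e) s V [A, B, C, D]"
  shows False
proof -
  define W where "W = \<Union>(set (Y # Zs @ [L]))"
  define U where "U = V - W"
  define P where "P = (\<lambda>X. R (X \<union> Y))"
  define Q where "Q = (\<lambda>B. \<not> R (B \<union> Y) \<and> \<not> R (B \<union> L))"
  have tail: "set_path R s V (Y # Zs @ [L])"
    using path by (auto simp: set_path_def)
  have sets: "\<forall>A\<in>set (Y # Zs @ [L]). A \<subseteq> V \<and> card A = s"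
    using tail unfolding set_path_def by blast
  then have fin: "\<forall>A\<in>set (Y # Zs @ [L]). finite A"
    using \<open>finite V\<close> finite_subset by blast
  have "W \<subseteq> V"
    using sets unfolding W_def by blast
  have "card W = length (Y # Zs @ [L]) * s"
    unfolding W_def using tail sets fin
    by (intro card_Union_disjoint_list) (blast, simp only: set_path_def)
  then have W: "W \<subseteq> V" "card W = (length Zs + 2) * s"
    using \<open>W \<subseteq> V\<close> by auto
  then have U: "finite U" "card U = 2 * s + 1"
    using cardV \<open>finite V\<close>
    by (auto simp: U_def card_Diff_subset[OF finite_subset] algebra_simps)
  have XU: "X \<subseteq> U" and X: "card X = s"
    using path by (auto simp: U_def W_def set_path_def disjnt_def)
  have "P X"
    using path by (simp add: P_def set_path_def)
  obtain B where B: "B \<subseteq> U" "card B = s" "disjnt B X"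
    using exists_disjoint_subset[OF U(1) XU, of s] U X by auto
  obtain Z Zs' where Zs: "Zs = Z # Zs'"
    using \<open>Zs \<noteq> []\<close> by (cases Zs) auto
  have outside: "A \<subseteq> V" "\<forall>D\<in>set (Y # Zs @ [L]). disjnt A D" "\<forall>D\<in>set (Y # Zs @ [L]). disjnt D A"
    if "A \<subseteq> U" for A
    using that by (auto simp: U_def W_def disjnt_def)
  have YL: "disjnt Y L" "disjnt Y Z" "disjnt Z L"
    using tail by (auto simp: set_path_def Zs sorted_wrt_append)
  have PQ: "Q B'" if X': "X' \<subseteq> U" "card X' = s" and B': "B' \<subseteq> U" "card B' = s"
    and disj: "disjnt X' B'" and "P X'" for X' B'
  proof -
    note out = outside[OF X'(1)] outside[OF B'(1)]
    have red: "R (X' \<union> Y)"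
      using \<open>P X'\<close> by (simp add: P_def)
    \<comment> \<open>\<open>BX\<close> and \<open>BL\<close> hold because \<open>B'\<close> must
      not prolong the path at its front or at its end.\<close>
    have BX: "\<not> R (B' \<union> X')"
      using no_R[of "B' # X' # Y # Zs @ [L]"] tail red X' B' out disj
      by (auto simp: set_path_def disjnt_sym)
    have BL: "\<not> R (B' \<union> L)"
    proof
      assume "R (B' \<union> L)"
      then have "set_path R s V (X' # Y # Zs @ [L, B'])"
        using tail red X' B' out disj
          successively_append_iff[of "\<lambda>A B. R (A \<union> B)" "Z # Zs'" "[L]"]
          successively_append_iff[of "\<lambda>A B. R (A \<union> B)" "Z # Zs'" "[L, B']"]
        by (auto simp: set_path_def sorted_wrt_append Zs Un_commute disjnt_sym)
      then show False
        using no_R[of "X' # Y # Zs @ [L, B']"] by simp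
    qed
    \<comment> \<open>Otherwise \<open>Z, X', B', L\<close> is a path in the other colour;
      \<open>Z\<close> comes from \<open>Zs\<close> and so is disjoint from
      \<open>L\<close>.\<close>
    have XZ: "R (X' \<union> Z)"
      using no_nR[of Z X' B' L] BX BL X' B' out disj YL sets
      by (auto simp: set_path_def Zs Un_commute disjnt_sym)
    \<comment> \<open>By \<open>XZ\<close> the path may also start \<open>Y, X', Z\<close>, and then
      \<open>B'\<close> must not be put before \<open>Y\<close>.\<close>
    have "\<not> R (B' \<union> Y)"
      using no_R[of "B' # Y # X' # Zs @ [L]"] XZ tail red X' B' out disj
      by (auto simp: set_path_def Zs Un_commute disjnt_sym)
    with BL show ?thesis
      by (simp add: Q_def)
  qed
  have QP: "P X'" if "X' \<subseteq> U" "card X' = s" "B' \<subseteq> U" "card B' = s" "disjnt X' B'" "Q B'" for X' B'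
    using no_nR[of X' Y B' L] that sets YL outside[of X'] outside[of B']
    by (auto simp: set_path_def P_def Q_def Un_commute)
  have "P B"
    by (rule odd_graph_walk[where P = P and Q = Q, OF U PQ QP XU X \<open>P X\<close> B(1,2)])
  moreover have "Q B"
    using PQ[OF XU X B(1,2) _ \<open>P X\<close>] B(3) by (simp add: disjnt_sym)
  ultimately show False
    by (simp add: P_def Q_def)
qed

lemma set_path_mono:
  "set_path R s V As \<Longrightarrow> V \<subseteq> V' \<Longrightarrow> set_path R s V' As"
  by (auto simp: set_path_def)

lemma set_path_ramsey:
  assumes "n \<ge> 3" "finite V" "card V = (n + 1) * s + 1"
    and "\<And>A B C D. \<not> set_path (\<lambda>e. \<not> R e) s V [A, B, C, D]"
  shows "\<exists>As. length As = n + 1 \<and> set_path R s V As"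
  using assms
proof (induction n arbitrary: V rule: dec_induct)
  case base
  then show ?case
    using set_path_ramsey_base[of V s R] by fastforce
next
  case (step n)
  \<comment> \<open>The induction hypothesis is applied with \<open>s\<close> vertices set aside;
    the path found is then viewed in all of \<open>V\<close>.\<close>
  obtain V' where V': "V' \<subseteq> V" "card V' = (n + 1) * s + 1"
    using obtain_subset_with_card_n[of "(n + 1) * s + 1" V] step.prems(2) by auto
  then obtain As where As: "length As = n + 1" "set_path R s V' As"
    using step.IH[of V'] step.prems finite_subset set_path_mono by metis
  obtain X Y As' where "As = X # Y # As'" "length As' = n - 1"
    using As(1) step.hyps(1) by (cases As; cases "tl As") auto
  moreover obtain Zs L where "As' = Zs @ [L]" "length Zs = n - 2"
    using calculation step.hyps(1) by (cases As' rule: rev_cases) auto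
  ultimately have *: "set_path R s V (X # Y # Zs @ [L])" "length Zs = n - 2"
    using As set_path_mono V' by auto
  have len: "length Zs + 4 = Suc n + 1" "Zs \<noteq> []"
    using * step.hyps(1) by auto
  show ?case
    using set_path_extension[OF step.prems(1) _ *(1) len(2)] step.prems(2,3) len(1) by metis
qed

section \<open>Copies of the hyperpath and the upper bound\<close>

lemma block_index:
  fixes j n s :: nat
  assumes "1 \<le> j" "j \<le> (n + 1) * s"
  shows "(j - 1) div s \<le> n" "(j - 1) div s * s < j" "j \<le> ((j - 1) div s + 1) * s"
proof -
  have "s > 0"
    using assms by (cases s) auto
  have "j - 1 < Suc n * s"
    using assms by simp
  then have "(j - 1) div s < Suc n"
    by (rule less_mult_imp_div_less)
  then show "(j - 1) div s \<le> n"
    by simp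
  show "(j - 1) div s * s < j"
    using assms div_times_less_eq_dividend[of "j - 1" s] by linarith
  show "j \<le> ((j - 1) div s + 1) * s"
    using dividend_less_div_times[of s "j - 1"] \<open>s > 0\<close> by simp
qed

text \<open>Bijections from the blocks of vertex numbers onto the entries of \<open>As\<close> are
  glued. Disjointness of the entries makes the glued map injective, and each edge is the union of
  two consecutive blocks.\<close>

lemma contains_copy_set_path:
  assumes "finite (verts G)" "s \<ge> 1" "set_path R s (verts G) As" "length As = n + 1"
    and edges: "\<And>e. e \<subseteq> verts G \<Longrightarrow> card e = 2 * s \<Longrightarrow> R e \<Longrightarrow> e \<in> edges G"
  shows "contains_copy G (hyperpath s n)"
proof -
  define blk where "blk = (\<lambda>i. {1 + i * s..(i + 1) * s})"
  have A: "As ! i \<subseteq> verts G" "card (As ! i) = s" "finite (As ! i)" if "i \<le> n" for i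
    using assms that finite_subset[of "As ! i" "verts G"] by (auto simp: set_path_def)
  have disj: "disjnt (As ! i) (As ! j)" if "i \<le> n" "j \<le> n" "i \<noteq> j" for i j
    using assms that by (cases i j rule: linorder_cases)
      (auto simp: set_path_def sorted_wrt_iff_nth_less disjnt_sym)
  have "\<exists>h. bij_betw h (blk i) (As ! i)" if "i \<le> n" for i
    using A[OF that] by (intro finite_same_card_bij) (auto simp: blk_def)
  then obtain h where h: "\<And>i. i \<le> n \<Longrightarrow> bij_betw (h i) (blk i) (As ! i)"
    by metis
  \<comment> \<open>Vertices are numbered from 1, so \<open>j\<close> lies in block
    \<open>(j - 1) div s\<close>, counted from 0.\<close>
  define f where "f = (\<lambda>j. h ((j - 1) div s) j)"
  have idx: "(j - 1) div s = i" if "j \<in> blk i" for i j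
    using that \<open>s \<ge> 1\<close> by (intro div_nat_eqI) (auto simp: blk_def algebra_simps)
  have mem: "(j - 1) div s \<le> n" "j \<in> blk ((j - 1) div s)" if "j \<in> {1..(n + 1) * s}" for j
    using block_index[of j n s] that by (auto simp: blk_def)
  have f_blk: "f ` blk i = As ! i" if "i \<le> n" for i
    using h[OF that] idx by (auto simp: f_def bij_betw_def image_iff)
  have "inj_on f {1..(n + 1) * s}"
  proof (rule inj_onI)
    fix j k
    assume jk: "j \<in> {1..(n + 1) * s}" "k \<in> {1..(n + 1) * s}" "f j = f k"
    define p q where "p = (j - 1) div s" and "q = (k - 1) div s"
    have p: "p \<le> n" "j \<in> blk p" and q: "q \<le> n" "k \<in> blk q"
      using mem jk by (auto simp: p_def q_def)
    then have "f j \<in> As ! p" "f j \<in> As ! q"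
      using f_blk jk(3) by (metis image_eqI)+
    then have "p = q"
      using disj[of p q] p q by (auto simp: disjnt_def)
    then show "j = k"
      using h[of p] p q jk(3) by (auto simp: f_def p_def q_def bij_betw_def inj_on_def)
  qed
  moreover have "f ` {1..(n + 1) * s} \<subseteq> verts G"
    using mem f_blk A(1) by (blast intro: imageI)
  moreover have "f ` {1 + i * s..(i + 2) * s} \<in> edges G" if "i < n" for i
  proof -
    have "{1 + i * s..(i + 2) * s} = blk i \<union> blk (Suc i)"
      by (auto simp: blk_def)
    then have eq: "f ` {1 + i * s..(i + 2) * s} = As ! i \<union> As ! Suc i"
      using f_blk that by (simp add: image_Un)
    show ?thesis
      unfolding eq
    proof (rule edges)
      show "As ! i \<union> As ! Suc i \<subseteq> verts G"
        using A that by auto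
      show "card (As ! i \<union> As ! Suc i) = 2 * s"
        using A disj that by (simp add: card_Un_disjnt)
      show "R (As ! i \<union> As ! Suc i)"
        using assms that by (auto simp: set_path_def successively_conv_nth)
    qed
  qed
  ultimately show ?thesis
    unfolding contains_copy_def hyperpath_def by (intro exI[of _ f]) auto
qed

lemma hyperpath_arrows:
  assumes "s \<ge> 1" "n \<ge> 3"
  shows "arrows (2 * s) ((n + 1) * s + 1) (hyperpath s n) (hyperpath s 3)"
  unfolding arrows_def
proof
  fix c :: "nat set \<Rightarrow> colour"
  define N where "N = (n + 1) * s + 1"
  define G where "G = (\<lambda>k. colour_class (complete_hypergraph (2 * s) N) c k)"
  have verts: "verts (G k) = {..<N}" for k
    by (simp add: G_def colour_class_def complete_hypergraph_def)
  have edges: "e \<in> edges (G k)" if "e \<subseteq> verts (G k)" "card e = 2 * s" "c e = k" for e k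
    using that by (simp add: G_def colour_class_def complete_hypergraph_def)
  have "contains_copy (G Red) (hyperpath s n) \<or> contains_copy (G Blue) (hyperpath s 3)"
  \<comment> \<open>Blue is written as not red, to be literally the negation of the predicate for
    red.\<close>
  proof (cases "\<exists>A B C D. set_path (\<lambda>e. \<not> c e = Red) s {..<N} [A, B, C, D]")
    case True
    then obtain A B C D where path: "set_path (\<lambda>e. \<not> c e = Red) s (verts (G Blue)) [A, B, C, D]"
      by (auto simp: verts)
    have "contains_copy (G Blue) (hyperpath s 3)"
    proof (rule contains_copy_set_path[OF _ \<open>s \<ge> 1\<close> path])
      show "e \<in> edges (G Blue)" if "e \<subseteq> verts (G Blue)" "card e = 2 * s" "\<not> c e = Red" for e
        using that edges[of e Blue] by (cases "c e") auto
    qed (simp_all add: verts)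
    then show ?thesis ..
  next
    case False
    then obtain As where "length As = n + 1" and path: "set_path (\<lambda>e. c e = Red) s (verts (G Red)) As"
      using set_path_ramsey[of n "{..<N}" s "\<lambda>e. c e = Red"] \<open>n \<ge> 3\<close> by (auto simp: N_def verts)
    then have "contains_copy (G Red) (hyperpath s n)"
      using edges by (intro contains_copy_set_path[OF _ \<open>s \<ge> 1\<close> path]) (simp_all add: verts)
    then show ?thesis ..
  qed
  then show "contains_copy (colour_class (complete_hypergraph (2 * s) ((n + 1) * s + 1)) c Red) (hyperpath s n) \<or>
      contains_copy (colour_class (complete_hypergraph (2 * s) ((n + 1) * s + 1)) c Blue) (hyperpath s 3)"
    by (simp add: G_def N_def)
qed

section \<open>Lower bound\<close>

text \<open>The edge that begins with the block of \<open>j\<close> serves, except for the last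
  block, which ends the last edge. Hence a copy whose edges all avoid a vertex avoids it
  altogether.\<close>

lemma hyperpath_vertex_in_edge:
  assumes "n \<ge> 1" "j \<in> verts (hyperpath s n)"
  shows "\<exists>e\<in>edges (hyperpath s n). j \<in> e"
proof -
  define p where "p = (j - 1) div s"
  have "1 \<le> j" "j \<le> (n + 1) * s"
    using assms by (auto simp: hyperpath_def)
  note p = block_index[OF this, folded p_def]
  show ?thesis
  proof (cases "p < n")
    case True
    then show ?thesis
      using p by (intro bexI[of _ "{1 + p * s..(p + 2) * s}"]) (auto simp: hyperpath_def)
  next
    case False
    then obtain m where "n = Suc m" "p = Suc m"
      using p(1) \<open>n \<ge> 1\<close> by (cases n) auto
    then show ?thesis
      using p by (intro bexI[of _ "{1 + m * s..(m + 2) * s}"]) (auto simp: hyperpath_def)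
  qed
qed

lemma hyperpath_not_arrows:
  assumes "n \<ge> 1" "N \<le> (n + 1) * s" "s \<ge> 1"
  shows "\<not> arrows (2 * s) N (hyperpath s n) (hyperpath s 3)"
proof -
  define c where "c = (\<lambda>e :: nat set. if 0 \<in> e then Blue else Red)"
  let ?G = "colour_class (complete_hypergraph (2 * s) N) c"
  have "\<not> contains_copy (?G Red) (hyperpath s n)"
  proof
    assume "contains_copy (?G Red) (hyperpath s n)"
    then obtain f where f: "inj_on f (verts (hyperpath s n))"
      "f ` verts (hyperpath s n) \<subseteq> {..<N}"
      "\<And>e. e \<in> edges (hyperpath s n) \<Longrightarrow> 0 \<notin> f ` e"
      by (auto simp: contains_copy_def colour_class_def complete_hypergraph_def c_def split: if_splits)
    have "0 \<notin> f ` verts (hyperpath s n)"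
      using f(3) hyperpath_vertex_in_edge[OF \<open>n \<ge> 1\<close>] by fastforce
    then have "f ` verts (hyperpath s n) \<subseteq> {..<N} - {0}"
      using f(2) by auto
    then have "card (verts (hyperpath s n)) \<le> card ({..<N} - {0})"
      using card_inj_on_le[OF f(1)] by simp
    moreover have "card (verts (hyperpath s n)) = (n + 1) * s"
      by (simp add: hyperpath_def)
    \<comment> \<open>This settles \<open>N = 0\<close>, where removing \<open>0\<close> from the
      vertex set does not make it smaller.\<close>
    moreover have "(n + 1) * s > 0"
      using \<open>s \<ge> 1\<close> by simp
    ultimately show False
      using \<open>N \<le> (n + 1) * s\<close> by (cases N) auto
  qed
  moreover have "\<not> contains_copy (?G Blue) (hyperpath s 3)"
  proof
    assume "contains_copy (?G Blue) (hyperpath s 3)"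
    then obtain f :: "nat \<Rightarrow> nat" where f: "inj_on f (verts (hyperpath s 3))"
      "\<And>e. e \<in> edges (hyperpath s 3) \<Longrightarrow> 0 \<in> f ` e"
      by (fastforce simp: contains_copy_def colour_class_def complete_hypergraph_def c_def split: if_splits)
    have "{1 + i * s..(i + 2) * s} \<in> edges (hyperpath s 3)" if "i < 3" for i
      using that by (auto simp: hyperpath_def)
    \<comment> \<open>The first and the third edge are disjoint, yet both images contain
      \<open>0\<close>.\<close>
    from f(2)[OF this[of 0]] f(2)[OF this[of 2]]
    have "0 \<in> f ` {1..2 * s}" "0 \<in> f ` {1 + 2 * s..4 * s}"
      by (simp_all add: mult_2)
    then obtain x y where xy: "x \<in> {1..2 * s}" "y \<in> {1 + 2 * s..4 * s}" "f x = f y"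
      by (metis imageE)
    then have "x \<in> verts (hyperpath s 3)" "y \<in> verts (hyperpath s 3)"
      by (simp_all add: hyperpath_def)
    then have "x = y"
      using inj_onD[OF f(1) xy(3)] by blast
    with xy show False
      by simp
  qed
  ultimately show ?thesis
    unfolding arrows_def by blast
qed

theorem theorem1:
  fixes s n :: nat
  assumes "s \<ge> 1" and "n \<ge> 3"
  shows "ramsey_number (2 * s) (hyperpath s n) (hyperpath s 3) = (n + 1) * s + 1"
  unfolding ramsey_number_def
proof (rule Least_equality)
  show "arrows (2 * s) ((n + 1) * s + 1) (hyperpath s n) (hyperpath s 3)"
    using assms by (rule hyperpath_arrows)
  show "(n + 1) * s + 1 \<le> N" if "arrows (2 * s) N (hyperpath s n) (hyperpath s 3)" for N
    using hyperpath_not_arrows[of n N s] that assms by linarith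
qed

end
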